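(* Let $h$ be an orientation preserving homeomorphism of the plane $\mathbb{R}^2$ whose only fixed point is $0$, and suppose that the Poincaré–Lefschetz index of the fixed point $0$ is different from $1$. Let $g$ be an orientation preserving homeomorphism of the plane fixing $0$. Then the cyclic words $\mathbf{M}(h)$ and $\mathbf{M}(g h g^{-1})$ coincide (that is, the quarter-turn index is a conjugacy invariant).
   Context: **Index.** The Poincaré–Lefschetz index $\mathrm{Ind}(h,0)$ is the degree (number of turns) of $x\mapsto h(x)-x$ along a small positively oriented circle around $0$. **Module.** A translation domain of $h$ is an open, connected, simply connected, $h$-invariant subset of the plane on which $h$ is conjugate to a translation. The module of $h$ is the smallest $k$ for which there exist translation domains $O_1,\dots,O_k$ such that $O_1\cup\dots\cup O_k$ separates $0$ from $\infty$ in the sphere $\mathbb{S}^2=\mathbb{R}^2\cup\{\infty\}$. **Order on connected subsets of the plane.** For disjoint connected $A,B\subset\mathbb{R}^2$, $O_A(B)$ is the connected component of $\mathbb{R}^2\setminus B$ containing $A$. Write $A<B<C$ if $A,B,C$ are connected, pairwise disjoint and $O_A(B)\neq O_C(B)$. Write $A\le B<C$ if $C$ is disjoint from $B$ and there is a connected component $O'$ of $\mathbb{R}^2\setminus B$, with $A\subset \overline{O'}$ and $O'\neq O_C(B)$; $A<B\le C$ is defined symmetrically. A chain of $k\ge 4$ sets holds if all $k$ chains of $k-1$ sets obtained by deleting one term hold (when a term is deleted, the relation between its two neighbours is strict as soon as one of the two relations involving it was). **Cyclic order in $\mathbb{R}^2\setminus\{0\}$.** Let $\pi:\mathbb{R}^2\to\mathbb{C}\setminus\{0\}\simeq\mathbb{R}^2\setminus\{0\}$,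 $\pi(\theta,r)=\exp(-r+2i\pi\theta)$, and $\tau(\theta,r)=(\theta+1,r)$. A lift of a connected set $A\subset \mathbb{R}^2\setminus\{0\}$ is a connected component of $\pi^{-1}(A)$. The cyclic order $A_1<A_2<\dots<A_k<A_1$ means that there are lifts $\tilde A_i$ of $A_i$ with $\tilde A_1<\tilde A_2<\dots<\tilde A_k<\tau(\tilde A_1)<\tau(\tilde A_2)<\cdots$; similarly when some of the $<$ are replaced by $\le$. **The sets $O(F,G)$.** For $F\subset\mathbb{R}^2\setminus\{0\}$ put $\hat F=F\cup\{0,\infty\}\subset\mathbb{S}^2$. If $F,G$ are disjoint, connected, closed in $\mathbb{R}^2\setminus\{0\}$, and $\hat F,\hat G$ are connected, then exactly two connected components of $\mathbb{R}^2\setminus(F\cup G\cup\{0\})$ have closure meeting both $F$ and $G$; they are denoted $O(F,G)$ and $O(G,F)$ in such a way that $F<O(F,G)<G<O(G,F)<F$. **Singular couples.** Let $U$ be an open set with $h(U)=U$ and $x,y$ two points not in the same $h$-orbit. The couple $(x,y)$ is singular via $U$ for $h$ if for all neighbourhoods $V_x,V_y$ of $x,y$ there is a positive integer $n$ with $h^n(V_x)\cap V_y\cap U\neq\emptyset$. **Reeb components.** A couple $(F,G)$ of (disjoint) subsets of $\mathbb{R}^2\setminus\{0\}$ is a Reeb component for $h$ if: $F,G$ are connected and closed in $\mathbb{R}^2\setminus\{0\}$; $\hat F,\hat G$ are connected; $h(F)=F$, $h(G)=G$; and there is $\varepsilon=\pm1$ such that every $(x,y)\in F\times G$ is singular via $O(F,G)$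 for $h^{\varepsilon}$. Its dynamics goes from $F$ to $G$ if $\varepsilon=1$, and from $G$ to $F$ if $\varepsilon=-1$. It is minimal if $F$ and $G$ are each minimal for inclusion among the subsets $K$ of $\mathbb{R}^2\setminus\{0\}$ that are closed in $\mathbb{R}^2\setminus\{0\}$, connected, and with $\hat K$ connected. For $h$ as in the claim, with module $d$, there are exactly $d$ minimal Reeb components, and they can be numbered, uniquely up to circular permutation, so that $F_1<O(F_1,G_1)<G_1\le F_2<\cdots<G_d\le F_1$; indices are taken modulo $d$. **Dynamical types.** For $h$ as in the claim, the negative (resp. positive) orbit of every point $x$ converges in $\mathbb{S}^2$ to a point $\alpha(x)\in\{0,\infty\}$ (resp. $\omega(x)\in\{0,\infty\}$). A boundary $F_k$ or $G_k$ contains either points with $\alpha=0,\omega=\infty$ or points with $\alpha=\infty,\omega=0$, but not both kinds; it is of dynamical type $0\to\infty$ in the first case, $\infty\to 0$ in the second. The adjacent boundaries $G_k$ and $F_{k+1}$ have the same type. **Cyclic words and quarter-turn index.** An indexed cyclic word of length $\ell$ is a sequence $(m_i)_{i\in\mathbb{Z}}$ of letters in $\{\leftarrow,\rightarrow,\uparrow,\downarrow\}$ with $m_{i+\ell}=m_i$; a cyclic word is a class of indexed cyclic words modulo shift of the index. The quarter-turn index of $h$ is the cyclic word $\mathbf{M}(h)$ of length $2d$ having the indexation $(m_i)$ given, for all $k$, by: $m_{2k}=\rightarrow$ if the dynamics of $(F_k,G_k)$ goes from $F_k$ to $G_k$, $m_{2k}=\leftarrow$ if it goes from $G_k$ to $F_k$;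 $m_{2k+1}=\uparrow$ if $G_k$ and $F_{k+1}$ are of type $\infty\to0$, $m_{2k+1}=\downarrow$ if they are of type $0\to\infty$. *)

theory Defs
  imports "HOL-Complex_Analysis.Complex_Analysis"
begin

section \<open>Plane, sphere, homeomorphisms, index\<close>

text \<open>The plane is the type of complex numbers and the sphere is its one-point compactification:
  \<open>Some z\<close> is the point \<open>z\<close> of the plane, \<open>None\<close> is the point at infinity.\<close>

definition sphere2 :: "complex option topology" where
  "sphere2 = Alexandroff_compactification (euclidean :: complex topology)"

definition plane_homeo :: "(complex \<Rightarrow> complex) \<Rightarrow> bool" where
  "plane_homeo h \<longleftrightarrow> (\<exists>h'. homeomorphism UNIV UNIV h h')"

text \<open>Orientation preserving means that the local degree is \<open>1\<close> at every point: the images of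
  positively oriented circles turn once, positively, around the image of the centre.\<close>

definition orientation_preserving_homeo :: "(complex \<Rightarrow> complex) \<Rightarrow> bool" where
  "orientation_preserving_homeo h \<longleftrightarrow>
     plane_homeo h \<and> (\<forall>z. \<forall>r>0. winding_number (h \<circ> circlepath z r) (h z) = 1)"

definition fixed_point_index :: "(complex \<Rightarrow> complex) \<Rightarrow> complex \<Rightarrow> int" where
  "fixed_point_index h p =
     (THE n. \<forall>\<^sub>F r in at_right 0.
        winding_number (\<lambda>t. h (circlepath p r t) - circlepath p r t) 0 = of_int n)"

section \<open>Module\<close>

definition translation_domain :: "(complex \<Rightarrow> complex) \<Rightarrow> complex set \<Rightarrow> bool" where
  "translation_domain h D \<longleftrightarrow>
     open D \<and> connected D \<and> simply_connected D \<and> h ` D = D \<and>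
     (\<exists>\<phi> \<psi> v. homeomorphism D (UNIV :: complex set) \<phi> \<psi> \<and> v \<noteq> 0 \<and>
        (\<forall>z\<in>D. \<phi> (h z) = \<phi> z + v))"

definition separates_zero_infinity :: "complex set \<Rightarrow> bool" where
  "separates_zero_infinity U \<longleftrightarrow> 0 \<notin> U \<and>
     \<not> connected_component_of (subtopology sphere2 (- Some ` U)) (Some 0) None"

definition plane_module :: "(complex \<Rightarrow> complex) \<Rightarrow> nat" where
  "plane_module h = (LEAST k. \<exists>D :: nat \<Rightarrow> complex set.
     (\<forall>i<k. translation_domain h (D i)) \<and> separates_zero_infinity (\<Union>i<k. D i))"

section \<open>Order on connected sets\<close>

text \<open>The component \<open>O_A(B)\<close> of the complement of \<open>B\<close> that contains \<open>A\<close>; only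
  meaningful for nonempty connected \<open>A\<close> disjoint from \<open>B\<close>.\<close>

definition side :: "'a::topological_space set \<Rightarrow> 'a set \<Rightarrow> 'a set" where
  "side A B = (THE C. C \<in> components (- B) \<and> A \<subseteq> C)"

definition order_lt_lt :: "'a::topological_space set \<Rightarrow> 'a set \<Rightarrow> 'a set \<Rightarrow> bool" where
  "order_lt_lt A B C \<longleftrightarrow>
     connected A \<and> connected B \<and> connected C \<and> A \<noteq> {} \<and> B \<noteq> {} \<and> C \<noteq> {} \<and>
     A \<inter> B = {} \<and> B \<inter> C = {} \<and> A \<inter> C = {} \<and> side A B \<noteq> side C B"

definition order_le_lt :: "'a::topological_space set \<Rightarrow> 'a set \<Rightarrow> 'a set \<Rightarrow> bool" where
  "order_le_lt A B C \<longleftrightarrow>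
     connected A \<and> connected B \<and> connected C \<and> A \<noteq> {} \<and> B \<noteq> {} \<and> C \<noteq> {} \<and>
     B \<inter> C = {} \<and> (\<exists>D \<in> components (- B). A \<subseteq> closure D \<and> D \<noteq> side C B)"

definition order_lt_le :: "'a::topological_space set \<Rightarrow> 'a set \<Rightarrow> 'a set \<Rightarrow> bool" where
  "order_lt_le A B C \<longleftrightarrow> order_le_lt C B A"

text \<open>The two Boolean arguments say whether the first and the second relation is strict.
  A chain with two consecutive nonstrict relations is given no meaning.\<close>

definition order3 ::
    "bool \<Rightarrow> bool \<Rightarrow> 'a::topological_space set \<Rightarrow> 'a set \<Rightarrow> 'a set \<Rightarrow> bool" where
  "order3 s t A B C \<longleftrightarrow>
     (if s then (if t then order_lt_lt A B C else order_lt_le A B C)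
      else (if t then order_le_lt A B C else False))"

text \<open>An infinite chain \<open>A 0, A 1, \<dots>\<close>, where \<open>s p\<close> says that the relation between \<open>A p\<close> and
  \<open>A (p + 1)\<close> is strict. Deleting terms repeatedly, a chain holds when all its three-term
  subchains hold, the relation between two terms being strict as soon as one of the relations
  between them is.\<close>

definition set_chain :: "(nat \<Rightarrow> 'a::topological_space set) \<Rightarrow> (nat \<Rightarrow> bool) \<Rightarrow> bool" where
  "set_chain A s \<longleftrightarrow> (\<forall>i j l. i < j \<and> j < l \<longrightarrow>
     order3 (\<exists>p\<in>{i..<j}. s p) (\<exists>p\<in>{j..<l}. s p) (A i) (A j) (A l))"

section \<open>Cyclic order in the punctured plane\<close>

definition cover :: "real \<times> real \<Rightarrow> complex" where
  "cover = (\<lambda>(\<theta>, r). exp (- of_real r + 2 * \<i> * of_real pi * of_real \<theta>))"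

definition deck :: "real \<times> real \<Rightarrow> real \<times> real" where
  "deck = (\<lambda>(\<theta>, r). (\<theta> + 1, r))"

definition lifts :: "complex set \<Rightarrow> (real \<times> real) set set" where
  "lifts A = components (cover -` A)"

text \<open>The cyclic order \<open>A 0, A 1, \<dots>, A (k - 1), A 0\<close>; \<open>s i\<close> says that the relation following
  \<open>A i\<close> is strict.\<close>

definition cyclic_chain :: "nat \<Rightarrow> (nat \<Rightarrow> complex set) \<Rightarrow> (nat \<Rightarrow> bool) \<Rightarrow> bool" where
  "cyclic_chain k A s \<longleftrightarrow> (\<exists>B :: nat \<Rightarrow> (real \<times> real) set.
     (\<forall>i<k. B i \<in> lifts (A i)) \<and> (\<forall>i. B (i + k) = deck ` B i) \<and>
     set_chain B (\<lambda>i. s (i mod k)))"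

section \<open>Reeb components\<close>

definition hat :: "complex set \<Rightarrow> complex option set" where
  "hat F = Some ` F \<union> {Some 0, None}"

definition joins_zero_infinity :: "complex set \<Rightarrow> bool" where
  "joins_zero_infinity F \<longleftrightarrow>
     F \<subseteq> - {0} \<and> closedin (top_of_set (- {0})) F \<and> connected F \<and> connectedin sphere2 (hat F)"

text \<open>\<open>regions F G U V\<close>: \<open>U\<close> is \<open>O(F,G)\<close> and \<open>V\<close> is \<open>O(G,F)\<close>.\<close>

definition regions ::
    "complex set \<Rightarrow> complex set \<Rightarrow> complex set \<Rightarrow> complex set \<Rightarrow> bool" where
  "regions F G U V \<longleftrightarrow>
     joins_zero_infinity F \<and> joins_zero_infinity G \<and> F \<inter> G = {} \<and>
     U \<in> components (- (F \<union> G \<union> {0})) \<and> V \<in> components (- (F \<union> G \<union> {0})) \<and> U \<noteq> V \<and>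
     closure U \<inter> F \<noteq> {} \<and> closure U \<inter> G \<noteq> {} \<and>
     closure V \<inter> F \<noteq> {} \<and> closure V \<inter> G \<noteq> {} \<and>
     cyclic_chain 4 ((!) [F, U, G, V]) (\<lambda>_. True)"

definition same_orbit :: "('a \<Rightarrow> 'a) \<Rightarrow> 'a \<Rightarrow> 'a \<Rightarrow> bool" where
  "same_orbit h x y \<longleftrightarrow> (\<exists>n. (h ^^ n) x = y \<or> (h ^^ n) y = x)"

definition singular_via ::
    "(complex \<Rightarrow> complex) \<Rightarrow> complex set \<Rightarrow> complex \<Rightarrow> complex \<Rightarrow> bool" where
  "singular_via h U x y \<longleftrightarrow>
     open U \<and> h ` U = U \<and> \<not> same_orbit h x y \<and>
     (\<forall>X Y. x \<in> interior X \<and> y \<in> interior Y \<longrightarrow> (\<exists>n>0. (h ^^ n) ` X \<inter> Y \<inter> U \<noteq> {}))"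

text \<open>Taking \<open>f = h\<close> (resp. \<open>f = inv h\<close>) below gives the condition for
  \<open>\<epsilon> = 1\<close> (resp. \<open>\<epsilon> = -1\<close>).\<close>

definition all_singular ::
    "(complex \<Rightarrow> complex) \<Rightarrow> complex set \<Rightarrow> complex set \<Rightarrow> bool" where
  "all_singular f F G \<longleftrightarrow>
     (\<exists>U V. regions F G U V \<and> (\<forall>x\<in>F. \<forall>y\<in>G. singular_via f U x y))"

definition reeb_component ::
    "(complex \<Rightarrow> complex) \<Rightarrow> complex set \<Rightarrow> complex set \<Rightarrow> bool" where
  "reeb_component h F G \<longleftrightarrow>
     joins_zero_infinity F \<and> joins_zero_infinity G \<and> F \<inter> G = {} \<and> h ` F = F \<and> h ` G = G \<and>
     (all_singular h F G \<or> all_singular (inv h) F G)"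

definition minimal_joining :: "complex set \<Rightarrow> bool" where
  "minimal_joining F \<longleftrightarrow>
     joins_zero_infinity F \<and> (\<forall>K. joins_zero_infinity K \<and> K \<subseteq> F \<longrightarrow> K = F)"

definition minimal_reeb_component ::
    "(complex \<Rightarrow> complex) \<Rightarrow> complex set \<Rightarrow> complex set \<Rightarrow> bool" where
  "minimal_reeb_component h F G \<longleftrightarrow>
     reeb_component h F G \<and> minimal_joining F \<and> minimal_joining G"

section \<open>Dynamical types\<close>

definition alpha_limit :: "(complex \<Rightarrow> complex) \<Rightarrow> complex \<Rightarrow> complex option \<Rightarrow> bool" where
  "alpha_limit h x p \<longleftrightarrow> limitin sphere2 (\<lambda>n. Some ((inv h ^^ n) x)) p sequentially"

definition omega_limit :: "(complex \<Rightarrow> complex) \<Rightarrow> complex \<Rightarrow> complex option \<Rightarrow> bool" where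
  "omega_limit h x p \<longleftrightarrow> limitin sphere2 (\<lambda>n. Some ((h ^^ n) x)) p sequentially"

definition has_connecting_orbit ::
    "(complex \<Rightarrow> complex) \<Rightarrow> complex option \<Rightarrow> complex option \<Rightarrow> complex set \<Rightarrow> bool" where
  "has_connecting_orbit h p q K \<longleftrightarrow> (\<exists>x\<in>K. alpha_limit h x p \<and> omega_limit h x q)"

definition type_zero_infinity :: "(complex \<Rightarrow> complex) \<Rightarrow> complex set \<Rightarrow> bool" where
  "type_zero_infinity h K \<longleftrightarrow>
     has_connecting_orbit h (Some 0) None K \<and> \<not> has_connecting_orbit h None (Some 0) K"

definition type_infinity_zero :: "(complex \<Rightarrow> complex) \<Rightarrow> complex set \<Rightarrow> bool" where
  "type_infinity_zero h K \<longleftrightarrow>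
     has_connecting_orbit h None (Some 0) K \<and> \<not> has_connecting_orbit h (Some 0) None K"

section \<open>Cyclic words and the quarter-turn index\<close>

datatype letter = Leftward | Rightward | Upward | Downward

definition indexed_cyclic_word :: "nat \<Rightarrow> (int \<Rightarrow> letter) \<Rightarrow> bool" where
  "indexed_cyclic_word l m \<longleftrightarrow> (\<forall>i. m (i + int l) = m i)"

text \<open>A cyclic word of length \<open>l\<close> is a class of indexed cyclic words modulo shift; every
  element of the class carries the length.\<close>

definition cyclic_word :: "nat \<Rightarrow> (int \<Rightarrow> letter) \<Rightarrow> (nat \<times> (int \<Rightarrow> letter)) set" where
  "cyclic_word l m = {(l, \<lambda>i. m (i + s)) | s. True}"

text \<open>The numberings of the minimal Reeb components, with indices modulo \<open>d\<close>, for which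
  \<open>F 0 < O(F 0, G 0) < G 0 \<le> F 1 < \<dots> < G (d - 1) \<le> F 0\<close>.\<close>

definition reeb_numbering ::
    "(complex \<Rightarrow> complex) \<Rightarrow> nat \<Rightarrow> (int \<Rightarrow> complex set) \<Rightarrow> (int \<Rightarrow> complex set) \<Rightarrow> bool" where
  "reeb_numbering h d F G \<longleftrightarrow>
     (\<forall>k. F (k + int d) = F k \<and> G (k + int d) = G k) \<and>
     bij_betw (\<lambda>k. (F k, G k)) {0..<int d} {(A, B). minimal_reeb_component h A B} \<and>
     (\<exists>U V. (\<forall>k. regions (F k) (G k) (U k) (V k)) \<and>
        cyclic_chain (3 * d)
          (\<lambda>i. [F (int (i div 3)), U (int (i div 3)), G (int (i div 3))] ! (i mod 3))
          (\<lambda>i. i mod 3 \<noteq> 2))"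

definition quarter_turn_indexation ::
    "(complex \<Rightarrow> complex) \<Rightarrow> (int \<Rightarrow> letter) \<Rightarrow> bool" where
  "quarter_turn_indexation h m \<longleftrightarrow>
     indexed_cyclic_word (2 * plane_module h) m \<and>
     (\<exists>F G. reeb_numbering h (plane_module h) F G \<and>
       (\<forall>k. (m (2 * k) = Rightward \<and> all_singular h (F k) (G k) \<or>
              m (2 * k) = Leftward \<and> all_singular (inv h) (F k) (G k)) \<and>
            (m (2 * k + 1) = Upward \<and>
                type_infinity_zero h (G k) \<and> type_infinity_zero h (F (k + 1)) \<or>
              m (2 * k + 1) = Downward \<and>
                type_zero_infinity h (G k) \<and> type_zero_infinity h (F (k + 1)))))"

text \<open>The numbering is unique up to circular permutation, so that all the indexations it gives
  are in the same class modulo shift. Taking the union of their classes yields this class without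
  relying on the uniqueness theorem in the definition.\<close>

definition quarter_turn_index ::
    "(complex \<Rightarrow> complex) \<Rightarrow> (nat \<times> (int \<Rightarrow> letter)) set" where
  "quarter_turn_index h =
     (\<Union>m \<in> {m. quarter_turn_indexation h m}. cyclic_word (2 * plane_module h) m)"

end

theory Submission
  imports Defs
begin

text \<open>
  The quarter-turn index is built from topological and dynamical data of \<open>h\<close>, so conjugation by
  a homeomorphism \<open>g\<close> fixing \<open>0\<close> carries each ingredient for \<open>h\<close> to the
  same ingredient for \<open>g \<circ> h \<circ> g\<inverse>\<close>: translation domains, joining sets, regions, Reeb components and
  orbits are replaced by their images under \<open>g\<close>. The points \<open>0\<close> and \<open>\<infinity>\<close> keep their roles because \<open>g\<close> fixes \<open>0\<close> and
  extends to a continuous map of the sphere that fixes \<open>\<infinity>\<close> (\<open>continuous_map_sphere\<close>).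

  Only the cyclic order sees the orientation. It is defined through lifts to the strip covering the
  punctured plane and through the deck transformation, so \<open>g\<close> has to be lifted to a homeomorphism
  \<open>L\<close> of the strip that commutes with the deck transformation. A lift is a continuous logarithm of
  \<open>g \<circ> exp\<close>; it is a homeomorphism because composing it with a lift of \<open>g\<inverse>\<close> gives a lift of the
  identity, hence a translation by a multiple of \<open>2\<pi>\<i>\<close> (\<open>exp_lift_homeomorphism\<close>). It
  satisfies \<open>L(x + 1) = L(x) + n\<close>, where \<open>n\<close> is the winding number of \<open>g\<close> along a circle
  around \<open>0\<close>, and \<open>n = 1\<close> expresses that \<open>g\<close> preserves orientation (\<open>exp_lift_translation\<close>). The order itself
  involves only components and closures in the strip, which every homeomorphism respects.

  The inverse of such a pair \<open>(g, L)\<close> is again such a pair. It therefore suffices to transport each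
  notion in one direction; where an equivalence is needed, as for minimality, the module and the
  negative halves of the dynamical types, the other direction is the same result for \<open>g\<inverse>\<close>.
\<close>

section \<open>Lifting to the universal cover of the punctured plane\<close>

text \<open>The difference of two lifts is continuous with values in the discrete set
  \<open>2\<pi>\<i>\<int>\<close>, hence constant. This uniqueness is what makes lifts of inverse maps inverse up to a
  period, and lifts equivariant up to a degree.\<close>

lemma exp_lifts_differ_by_period:
  fixes f1 f2 :: "complex \<Rightarrow> complex"
  assumes "continuous_on UNIV f1" "continuous_on UNIV f2" and eq: "\<And>z. exp (f1 z) = exp (f2 z)"
  obtains n :: int where "\<And>z. f1 z = f2 z + 2 * of_int n * of_real pi * \<i>"
proof -
  define d where "d = (\<lambda>z. f1 z - f2 z)"
  have period: "\<exists>n::int. d z = of_int (2 * n) * of_real pi * \<i>" for z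
    using eq[of z] unfolding exp_eq d_def by (auto simp: algebra_simps)
  have "d constant_on UNIV"
  proof (rule continuous_discrete_range_constant)
    show "connected (UNIV :: complex set)" by (rule connected_UNIV)
    show "continuous_on UNIV d" unfolding d_def by (intro continuous_intros assms)
    show "\<exists>e>0. \<forall>y. y \<in> UNIV \<and> d y \<noteq> d z \<longrightarrow> e \<le> norm (d y - d z)" for z
    proof (intro exI[of _ "2 * pi"] conjI allI impI)
      fix y assume ne: "y \<in> UNIV \<and> d y \<noteq> d z"
      obtain m n :: int
        where m: "d y = of_int (2 * m) * of_real pi * \<i>" and n: "d z = of_int (2 * n) * of_real pi * \<i>"
        using period by meson
      have "d y - d z = of_real (2 * of_int (m - n) * pi) * \<i>"
        by (simp add: m n algebra_simps)
      then have "norm (d y - d z) = \<bar>2 * of_int (m - n) * pi\<bar>"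
        by (simp only: norm_mult norm_of_real norm_ii mult_1_right)
      then have norm: "norm (d y - d z) = 2 * \<bar>of_int (m - n)\<bar> * pi"
        unfolding abs_mult by simp
      have "m \<noteq> n" using ne m n by auto
      then have "1 \<le> \<bar>real_of_int (m - n)\<bar>" by linarith
      then show "2 * pi \<le> norm (d y - d z)"
        unfolding norm using pi_gt_zero by (simp add: mult_le_cancel_right1)
    qed simp
  qed
  then obtain c where c: "\<And>z. d z = c" by (auto simp: constant_on_def)
  obtain n :: int where "c = of_int (2 * n) * of_real pi * \<i>" using period c by metis
  then have "f1 z = f2 z + 2 * of_int n * of_real pi * \<i>" for z
    using c[of z] by (simp add: d_def algebra_simps)
  then show ?thesis by (rule that)
qed

lemma exp_lift_exists:
  assumes "continuous_on UNIV g" "\<And>z. z \<noteq> 0 \<Longrightarrow> g z \<noteq> (0::complex)"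
  obtains l :: "complex \<Rightarrow> complex" where "continuous_on UNIV l" "\<And>z. exp (l z) = g (exp z)"
proof -
  have "continuous_on UNIV (\<lambda>z. g (exp z))"
    by (rule continuous_on_compose2[OF assms(1)]) (auto intro: continuous_intros)
  moreover have "contractible (UNIV :: complex set)"
    by (rule convex_imp_contractible[OF convex_UNIV])
  moreover have "g (exp z) \<noteq> 0" for z by (simp add: assms(2))
  ultimately obtain l where "continuous_on UNIV l" "\<And>z. z \<in> UNIV \<Longrightarrow> g (exp z) = exp (l z)"
    using continuous_logarithm_on_contractible[of UNIV "\<lambda>z. g (exp z)"] by blast
  then show ?thesis by (intro that[of l]) auto
qed

text \<open>Both compositions of a lift of \<open>g\<close> with a lift of its inverse are lifts of the identity, so
  they are translations; subtracting one of them turns the second lift into an inverse.\<close>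

lemma exp_lift_homeomorphism:
  assumes g: "homeomorphism UNIV UNIV g g'" "g 0 = (0::complex)"
  obtains l l' :: "complex \<Rightarrow> complex"
    where "homeomorphism UNIV UNIV l l'" "\<And>z. exp (l z) = g (exp z)"
proof -
  have inv: "g' (g z) = z" "g (g' z) = z" for z
    using g(1) by (auto simp: homeomorphism_def)
  have cont: "continuous_on UNIV g" "continuous_on UNIV g'"
    using g(1) by (auto simp: homeomorphism_def)
  have nz: "z \<noteq> 0 \<Longrightarrow> g z \<noteq> 0" "z \<noteq> 0 \<Longrightarrow> g' z \<noteq> 0" for z
    using inv g(2) by metis+
  obtain l where l: "continuous_on UNIV l" "\<And>z. exp (l z) = g (exp z)"
    using exp_lift_exists[OF cont(1) nz(1)] by metis
  obtain k where k: "continuous_on UNIV k" "\<And>z. exp (k z) = g' (exp z)"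
    using exp_lift_exists[OF cont(2) nz(2)] by metis
  have kl: "continuous_on UNIV (\<lambda>z. k (l z))" "continuous_on UNIV (\<lambda>z. l (k z))"
    by (auto intro: continuous_on_compose2 l(1) k(1))
  obtain m where m: "\<And>z. k (l z) = z + 2 * of_int m * of_real pi * \<i>"
    using exp_lifts_differ_by_period[OF kl(1) continuous_on_id] by (auto simp: l k inv)
  obtain n where n: "\<And>z. l (k z) = z + 2 * of_int n * of_real pi * \<i>"
    using exp_lifts_differ_by_period[OF kl(2) continuous_on_id] by (auto simp: l k inv)
  define l' where "l' = (\<lambda>w. k w - 2 * of_int m * of_real pi * \<i>)"
  have left: "l' (l z) = z" for z by (simp add: l'_def m)
  \<comment> \<open>Being surjective, \<open>l\<close> has its left inverse as a two-sided inverse.\<close>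
  have right: "l (l' w) = w" for w
  proof -
    have "l (k (w - 2 * of_int n * of_real pi * \<i>)) = w" by (simp add: n)
    then show ?thesis using left by metis
  qed
  have "continuous_on UNIV l'" unfolding l'_def by (intro continuous_intros k(1))
  then have "homeomorphism UNIV UNIV l l'"
    using l(1) left right by (intro homeomorphismI) auto
  then show ?thesis using l(2) that by blast
qed

text \<open>The path \<open>t \<mapsto> l (2\<pi>\<i>t)\<close> lifts the image under \<open>g\<close> of the unit circle, so its total
  increment is \<open>2\<pi>\<i>\<close> times the winding number. This is the only place where the orientation of
  \<open>g\<close> enters.\<close>

lemma exp_lift_translation:
  assumes l: "continuous_on UNIV l" "\<And>z. exp (l z) = g (exp z)"
    and turn: "winding_number (g \<circ> circlepath 0 1) 0 = 1"
  shows "l (z + 2 * of_real pi * \<i>) = l z + 2 * of_real pi * \<i>"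
proof -
  let ?T = "2 * of_real pi * \<i> :: complex"
  have "continuous_on UNIV (\<lambda>z. l (z + ?T))"
    by (rule continuous_on_compose2[OF l(1)]) (auto intro: continuous_intros)
  moreover have "exp (l (z + ?T)) = exp (l z)" for z
    by (simp add: l(2) exp_add)
  ultimately obtain n :: int where n: "\<And>z. l (z + ?T) = l z + 2 * of_int n * of_real pi * \<i>"
    using exp_lifts_differ_by_period l(1) by blast
  define p where "p = (\<lambda>t::real. l (?T * of_real t))"
  have "path p" unfolding path_def p_def
    by (rule continuous_on_compose2[OF l(1)]) (auto intro!: continuous_intros)
  moreover have "exp \<circ> p = g \<circ> circlepath 0 1"
    by (simp add: fun_eq_iff p_def l(2) circlepath mult_ac)
  ultimately have "(pathfinish p - pathstart p) / (2 * of_real pi * \<i>) = 1"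
    using winding_number_compose_exp[of p] turn by simp
  moreover have "pathfinish p = pathstart p + 2 * of_int n * of_real pi * \<i>"
    using n[of 0] by (simp add: p_def pathfinish_def pathstart_def)
  ultimately have "of_int n = (1::complex)" by (simp add: field_simps)
  then show ?thesis using n[of z] by simp
qed

text \<open>The linear change of coordinates that turns \<open>cover\<close> into the complex exponential and the
  deck transformation into the translation by \<open>2\<pi>\<i>\<close>.\<close>

definition strip_to_plane :: "real \<times> real \<Rightarrow> complex" where
  "strip_to_plane x = Complex (- snd x) (2 * pi * fst x)"

definition plane_to_strip :: "complex \<Rightarrow> real \<times> real" where
  "plane_to_strip z = (Im z / (2 * pi), - Re z)"

lemma homeomorphism_strip_to_plane: "homeomorphism UNIV UNIV strip_to_plane plane_to_strip"
proof (rule homeomorphismI)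
  show "continuous_on UNIV strip_to_plane"
    unfolding strip_to_plane_def Complex_eq by (intro continuous_intros)
  show "continuous_on UNIV plane_to_strip"
    unfolding plane_to_strip_def by (intro continuous_intros) auto
qed (auto simp: strip_to_plane_def plane_to_strip_def)

lemma cover_eq_exp: "cover x = exp (strip_to_plane x)"
  by (cases x) (simp add: cover_def strip_to_plane_def Complex_eq mult_ac)

lemma strip_to_plane_deck: "strip_to_plane (deck x) = strip_to_plane x + 2 * of_real pi * \<i>"
  by (cases x) (simp add: deck_def strip_to_plane_def Complex_eq algebra_simps)

text \<open>Orientation is recorded by the commutation with \<open>deck\<close>: the lift of an orientation reversing
  homeomorphism would conjugate \<open>deck\<close> to its inverse. Keeping the lift and both inverses as
  parameters makes the notion visibly symmetric in \<open>g\<close> and \<open>g'\<close>.\<close>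

locale lifted_homeo =
  fixes g g' :: "complex \<Rightarrow> complex" and L L' :: "real \<times> real \<Rightarrow> real \<times> real"
  assumes homeo: "homeomorphism UNIV UNIV g g'" and zero: "g 0 = 0"
    and lift_homeo: "homeomorphism UNIV UNIV L L'"
    and cover_lift: "cover (L x) = g (cover x)"
    and deck_lift: "L (deck x) = deck (L x)"

lemma orientation_preserving_lifted_homeo:
  assumes "orientation_preserving_homeo g" "g 0 = 0"
  obtains L L' where "lifted_homeo g (inv g) L L'"
proof -
  obtain g' where g': "homeomorphism UNIV UNIV g g'"
    using assms(1) by (auto simp: orientation_preserving_homeo_def plane_homeo_def)
  then have "g' = inv g" by (auto simp: homeomorphism_def intro!: inv_unique_comp[symmetric])
  with g' have g: "homeomorphism UNIV UNIV g (inv g)" by simp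
  obtain l l' where l: "homeomorphism UNIV UNIV l l'" "\<And>z. exp (l z) = g (exp z)"
    using exp_lift_homeomorphism[OF g assms(2)] by blast
  have "winding_number (g \<circ> circlepath 0 1) 0 = 1"
    using assms by (metis orientation_preserving_homeo_def zero_less_one)
  then have trans: "l (z + 2 * of_real pi * \<i>) = l z + 2 * of_real pi * \<i>" for z
    using exp_lift_translation[of l g] l by (auto simp: homeomorphism_def)
  let ?L = "plane_to_strip \<circ> (l \<circ> strip_to_plane)"
    and ?L' = "(plane_to_strip \<circ> l') \<circ> strip_to_plane"
  have inv: "strip_to_plane (plane_to_strip z) = z" "plane_to_strip (strip_to_plane x) = x" for z x
    using homeomorphism_strip_to_plane unfolding homeomorphism_def by blast+
  have "homeomorphism UNIV UNIV ?L ?L'"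
    by (rule homeomorphism_compose[OF homeomorphism_compose[OF homeomorphism_strip_to_plane l(1)]
          homeomorphism_symD[OF homeomorphism_strip_to_plane]])
  moreover have "cover (?L x) = g (cover x)" for x
    by (simp add: cover_eq_exp inv l(2))
  moreover have "?L (deck x) = deck (?L x)" for x
  proof -
    have "strip_to_plane (?L (deck x)) = strip_to_plane (deck (?L x))"
      by (simp add: inv strip_to_plane_deck trans)
    then show ?thesis using inv(2) by metis
  qed
  ultimately have "lifted_homeo g (inv g) ?L ?L'"
    using g assms(2) by unfold_locales auto
  then show ?thesis by (rule that)
qed


section \<open>Components and the order under a homeomorphism\<close>

lemma homeomorphism_component_image:
  assumes f: "homeomorphism UNIV UNIV f f'" and C: "C \<in> components S"
  shows "f ` C \<in> components (f ` S)"
proof -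
  have inv: "f' (f x) = x" "f (f' y) = y" for x y using f by (auto simp: homeomorphism_def)
  have cont: "continuous_on A f" "continuous_on B f'" for A B
    using f by (auto simp: homeomorphism_def intro: continuous_on_subset)
  have max: "D = f ` C" if D: "D \<noteq> {}" "f ` C \<subseteq> D" "D \<subseteq> f ` S" "connected D" for D
  proof -
    have "C \<subseteq> f' ` D" using D(2) inv by (metis image_eqI image_subset_iff subsetI)
    moreover have "f' ` D \<subseteq> S" using D(3) inv by auto
    moreover have "connected (f' ` D)" using D(4) cont by (intro connected_continuous_image)
    ultimately have "f' ` D = C" using C D(1) by (auto simp: in_components_maximal)
    then show ?thesis using inv by (auto simp: image_image)
  qed
  have "connected (f ` C)"
    using in_components_connected[OF C] cont by (intro connected_continuous_image)
  then show ?thesis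
    unfolding in_components_maximal[of "f ` C"]
    using max in_components_nonempty[OF C] in_components_subset[OF C] by auto
qed

text \<open>Outside the situations of the next two lemmas the description in \<open>side\<close> is
  unspecified; the order relations only use it where they apply.\<close>

lemma side_unique:
  assumes "C \<in> components (- B)" "A \<subseteq> C" "A \<noteq> {}"
  shows "side A B = C"
  unfolding side_def
proof (rule the_equality)
  show "D = C" if "D \<in> components (- B) \<and> A \<subseteq> D" for D
    using that assms components_nonoverlap[of C "- B" D] by blast
qed (use assms in simp)

lemma side_component:
  assumes "connected A" "A \<noteq> {}" "A \<inter> B = {}"
  shows "side A B \<in> components (- B)" "A \<subseteq> side A B"
proof -
  obtain C where "C \<in> components (- B)" "A \<subseteq> C"
    using exists_component_superset[of A "- B"] assms by (metis disjoint_eq_subset_Compl empty_subsetI subset_empty)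
  then show "side A B \<in> components (- B)" "A \<subseteq> side A B"
    using side_unique[of C B A] assms(2) by auto
qed

context
  fixes f :: "'a::topological_space \<Rightarrow> 'b::topological_space" and f' :: "'b \<Rightarrow> 'a"
  assumes f: "homeomorphism UNIV UNIV f f'"
begin

lemma homeomorphism_inj_surj: "inj f" "surj f"
  using f unfolding homeomorphism_def by (metis injI iso_tuple_UNIV_I) (use f in \<open>auto simp: homeomorphism_def\<close>)

lemma homeomorphism_compl_image: "- (f ` B) = f ` (- B)"
  using homeomorphism_inj_surj by (metis bij_image_Compl_eq bijI)

lemma homeomorphism_connected_image: "connected A \<Longrightarrow> connected (f ` A)"
  using f by (meson connected_continuous_image continuous_on_subset homeomorphism_def subset_UNIV)

lemma homeomorphism_side_image:
  assumes "connected A" "A \<noteq> {}" "A \<inter> B = {}"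
  shows "side (f ` A) (f ` B) = f ` side A B"
  using side_component[OF assms] homeomorphism_component_image[OF f, of _ "- B"] assms(2)
  by (intro side_unique) (auto simp: homeomorphism_compl_image)

lemma homeomorphism_disjoint_image: "A \<inter> B = {} \<Longrightarrow> f ` A \<inter> f ` B = {}"
  using homeomorphism_inj_surj(1) by (metis image_Int image_empty)

lemma homeomorphism_subset_closure_image: "A \<subseteq> closure D \<Longrightarrow> f ` A \<subseteq> closure (f ` D)"
  using f image_closure_subset[of D f "closure (f ` D)"]
  by (metis closed_closure closure_subset continuous_on_subset homeomorphism_def image_mono
      order.trans subset_UNIV)

lemma order_lt_lt_image: "order_lt_lt A B C \<Longrightarrow> order_lt_lt (f ` A) (f ` B) (f ` C)"
  unfolding order_lt_lt_def
  by (simp add: homeomorphism_side_image homeomorphism_disjoint_image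
      homeomorphism_connected_image inj_image_eq_iff[OF homeomorphism_inj_surj(1)] Int_commute)

lemma order_le_lt_image:
  assumes "order_le_lt A B C"
  shows "order_le_lt (f ` A) (f ` B) (f ` C)"
proof -
  obtain D where D: "D \<in> components (- B)" "A \<subseteq> closure D" "D \<noteq> side C B"
    using assms by (auto simp: order_le_lt_def)
  have "f ` D \<in> components (- (f ` B))"
    using homeomorphism_component_image[OF f D(1)] by (simp add: homeomorphism_compl_image)
  moreover have "f ` D \<noteq> side (f ` C) (f ` B)"
    using assms D(3) by (simp add: order_le_lt_def homeomorphism_side_image Int_commute
        inj_image_eq_iff[OF homeomorphism_inj_surj(1)])
  ultimately show ?thesis
    using assms homeomorphism_subset_closure_image[OF D(2)] unfolding order_le_lt_def
    by (auto simp: homeomorphism_connected_image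
        simp del: image_Int dest: homeomorphism_disjoint_image)
qed

lemma order3_image: "order3 s t A B C \<Longrightarrow> order3 s t (f ` A) (f ` B) (f ` C)"
  using order_lt_lt_image[of A B C] order_le_lt_image[of A B C] order_le_lt_image[of C B A]
  by (simp add: order3_def order_lt_le_def split: if_splits)

lemma set_chain_image: "set_chain B s \<Longrightarrow> set_chain (\<lambda>i. f ` B i) s"
  unfolding set_chain_def using order3_image by blast

end


section \<open>Transport by a homeomorphism with an equivariant lift\<close>

context lifted_homeo
begin

lemma inverse_simps [simp]: "g' (g z) = z" "g (g' z) = z" "L' (L x) = x" "L (L' x) = x"
  using homeo lift_homeo unfolding homeomorphism_def by blast+

lemma zero_simps [simp]: "g z = 0 \<longleftrightarrow> z = 0" "g 0 = 0" "g' 0 = 0"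
  using zero inverse_simps(1,2) by metis+

lemma image_simps [simp]: "g' ` g ` A = A" "g ` g' ` A = A" "g' \<circ> (g \<circ> h \<circ> g') \<circ> g = h"
  by (auto simp: image_image fun_eq_iff)

lemma bij_g: "bij g"
  by (rule o_bij[of g']) (auto simp: fun_eq_iff)

lemma inj_g: "inj g" 
  using bij_g by (simp add: bij_def)

lemma continuous: "continuous_on A g" "continuous_on A g'"
  using homeo by (auto simp: homeomorphism_def intro: continuous_on_subset)

text \<open>This symmetry gives the reverse directions of all the transport lemmas below.\<close>

lemma lifted_homeo_inverse: "lifted_homeo g' g L' L"
proof
  show "homeomorphism UNIV UNIV g' g" "homeomorphism UNIV UNIV L' L"
    by (rule homeomorphism_symD, rule homeo, rule homeomorphism_symD, rule lift_homeo)
  show "cover (L' x) = g' (cover x)" for x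
    using cover_lift[of "L' x"] by (metis inverse_simps)
  show "L' (deck x) = deck (L' x)" for x
    using deck_lift[of "L' x"] by (metis inverse_simps)
qed simp

lemma open_image: "open U \<Longrightarrow> open (g ` U)"
  using homeomorphism_imp_open_map[OF homeo, of U] by simp

lemma components_image: "U \<in> components S \<Longrightarrow> g ` U \<in> components (g ` S)"
  by (rule homeomorphism_component_image[OF homeo])

lemma conjugate_funpow: "(g \<circ> h \<circ> g') ^^ n = g \<circ> (h ^^ n) \<circ> g'"
  by (induction n) (auto simp: fun_eq_iff)

lemma inv_conjugate: "bij h \<Longrightarrow> inv (g \<circ> h \<circ> g') = g \<circ> inv h \<circ> g'"
  by (rule inv_unique_comp) (auto simp: fun_eq_iff bij_is_surj surj_f_inv_f bij_is_inj)

lemma conjugate_image: "(g \<circ> h \<circ> g') ` (g ` A) = g ` h ` A"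
  by (auto simp: image_image)

subsection \<open>The sphere\<close>

text \<open>Neighbourhoods of \<open>\<infinity>\<close> are complements of compact sets, and the preimage of a compact set
  under \<open>g\<close> is its image under the continuous inverse, hence compact.\<close>

lemma continuous_map_sphere: "continuous_map sphere2 sphere2 (map_option g)"
  unfolding continuous_map_def
proof (intro conjI allI impI)
  show "map_option g \<in> topspace sphere2 \<rightarrow> topspace sphere2"
    by (auto simp: sphere2_def)
  fix V assume "openin sphere2 V"
  then consider U where "open U" "V = Some ` U"
    | C where "compact C" "V = insert None (Some ` (- C))"
    unfolding sphere2_def openin_Alexandroff_compactification by (auto simp: Compl_eq_Diff_UNIV)
  then show "openin sphere2 {x \<in> topspace sphere2. map_option g x \<in> V}"
  proof cases
    case 1
    have "{x \<in> topspace sphere2. map_option g x \<in> V} = Some ` (g -` U)"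
      using 1 by (auto simp: sphere2_def) 
    then show ?thesis
      using 1 continuous by (auto simp: sphere2_def open_vimage)
  next
    case 2
    have "x \<in> g' ` C \<longleftrightarrow> g x \<in> C" for x by (metis image_iff inverse_simps(1,2))
    then have "{x \<in> topspace sphere2. map_option g x \<in> V} = insert None (Some ` (- (g' ` C)))"
      using 2 by (auto simp: sphere2_def split: option.splits)
    moreover have "compact (g' ` C)" using 2 continuous by (intro compact_continuous_image)
    ultimately show ?thesis
      by (auto simp: sphere2_def openin_Alexandroff_compactification Compl_eq_Diff_UNIV
          compact_imp_closed)
  qed
qed

lemma connectedin_sphere_image:
  "connectedin sphere2 S \<Longrightarrow> connectedin sphere2 (map_option g ` S)"
  by (rule connectedin_continuous_map_image[OF continuous_map_sphere])

lemma limitin_sphere_image: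
  "limitin sphere2 u p F \<Longrightarrow> limitin sphere2 (\<lambda>n. map_option g (u n)) (map_option g p) F"
  using continuous_map_limit[OF continuous_map_sphere] by (simp add: comp_def)

subsection \<open>Module\<close>

lemma translation_domain_image:
  assumes "translation_domain h D"
  shows "translation_domain (g \<circ> h \<circ> g') (g ` D)"
proof -
  have D: "open D" "connected D" "simply_connected D" "h ` D = D"
    and "\<exists>\<phi> \<psi> v. homeomorphism D (UNIV :: complex set) \<phi> \<psi> \<and> v \<noteq> 0 \<and> (\<forall>z\<in>D. \<phi> (h z) = \<phi> z + v)"
    using assms unfolding translation_domain_def by simp_all
  then obtain \<phi> :: "complex \<Rightarrow> complex" and \<psi> v
    where \<phi>: "homeomorphism D UNIV \<phi> \<psi>" "v \<noteq> 0" "\<forall>z\<in>D. \<phi> (h z) = \<phi> z + v"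
    by blast
  have gD: "homeomorphism D (g ` D) g g'"
    using continuous by (auto simp: homeomorphism_def)
  have "homeomorphism (g ` D) UNIV (\<phi> \<circ> g') (g \<circ> \<psi>)"
    by (rule homeomorphism_compose[OF homeomorphism_symD[OF gD] \<phi>(1)])
  moreover have "simply_connected (g ` D)"
    using D(3) gD homeomorphic_simply_connected homeomorphic_def by blast
  moreover have "connected (g ` D)"
    using D(2) continuous by (intro connected_continuous_image)
  ultimately show ?thesis
    unfolding translation_domain_def conjugate_image using D(1,4) open_image \<phi>(2,3)
    by (intro conjI exI[of _ "\<phi> \<circ> g'"] exI[of _ "g \<circ> \<psi>"] exI[of _ v]) auto
qed

text \<open>A connected subset of the sphere joining \<open>0\<close> to \<open>\<infinity>\<close> outside the image of \<open>U\<close> is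
  pulled back by \<open>g\<close> to one that avoids \<open>U\<close>.\<close>

lemma separates_zero_infinity_image:
  assumes "separates_zero_infinity U"
  shows "separates_zero_infinity (g ` U)"
proof -
  interpret inverse: lifted_homeo g' g L' L by (rule lifted_homeo_inverse)
  have "connected_component_of (subtopology sphere2 (- Some ` U)) (Some 0) None"
    if joined: "connected_component_of (subtopology sphere2 (- Some ` g ` U)) (Some 0) None"
  proof -
    obtain T where T: "connectedin sphere2 T" "T \<subseteq> - Some ` g ` U" "Some 0 \<in> T" "None \<in> T"
      using joined unfolding connected_component_of_def connectedin_subtopology by blast
    let ?T = "map_option g' ` T"
    have "connectedin sphere2 ?T" by (rule inverse.connectedin_sphere_image[OF T(1)])
    moreover have "?T \<subseteq> - Some ` U"
    proof (rule image_subsetI)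
      fix p assume p: "p \<in> T"
      show "map_option g' p \<in> - Some ` U"
      proof (rule ComplI)
        assume "map_option g' p \<in> Some ` U"
        then obtain x where "p = Some x" "g' x \<in> U" by (cases p) auto
        then have "p \<in> Some ` g ` U" by (metis image_eqI inverse_simps(2))
        with p T(2) show False by blast
      qed
    qed
    moreover have "Some 0 \<in> ?T" "None \<in> ?T"
      using T(3,4) by (auto simp: image_iff intro: bexI[of _ "Some 0"] bexI[of _ None])
    ultimately show ?thesis
      unfolding connected_component_of_def connectedin_subtopology by blast
  qed
  then show ?thesis using assms by (auto simp: separates_zero_infinity_def)
qed

lemma plane_module_conjugate: "plane_module (g \<circ> h \<circ> g') = plane_module h"
proof -
  interpret inverse: lifted_homeo g' g L' L by (rule lifted_homeo_inverse)
  let ?P = "\<lambda>h k. \<exists>D :: nat \<Rightarrow> complex set.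
     (\<forall>i<k. translation_domain h (D i)) \<and> separates_zero_infinity (\<Union>i<k. D i)"
  have fwd: "?P (g \<circ> h \<circ> g') k" if P: "?P h k" for h k
  proof -
    obtain D where D: "\<forall>i<k. translation_domain h (D i)" "separates_zero_infinity (\<Union>i<k. D i)"
      using P by blast
    have "separates_zero_infinity (\<Union>i<k. g ` D i)"
      using separates_zero_infinity_image[OF D(2)] by (simp add: image_UN)
    with D(1) translation_domain_image show ?thesis
      by (intro exI[of _ "\<lambda>i. g ` D i"]) auto
  qed
  have bwd: "?P (g' \<circ> h \<circ> g) k" if P: "?P h k" for h k
  proof -
    obtain D where D: "\<forall>i<k. translation_domain h (D i)" "separates_zero_infinity (\<Union>i<k. D i)"
      using P by blast
    have "separates_zero_infinity (\<Union>i<k. g' ` D i)"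
      using inverse.separates_zero_infinity_image[OF D(2)] by (simp add: image_UN)
    with D(1) inverse.translation_domain_image show ?thesis
      by (intro exI[of _ "\<lambda>i. g' ` D i"]) auto
  qed
  have "?P (g \<circ> h \<circ> g') k \<longleftrightarrow> ?P h k" for k
    using fwd[of k h] bwd[of k "g \<circ> h \<circ> g'"] unfolding image_simps by blast
  then show ?thesis by (simp add: plane_module_def)
qed

subsection \<open>Cyclic order\<close>

lemma lifts_image:
  assumes "B \<in> lifts A"
  shows "L ` B \<in> lifts (g ` A)"
proof -
  interpret inverse: lifted_homeo g' g L' L by (rule lifted_homeo_inverse)
  have "cover -` (g ` A) = L ` (cover -` A)"
  proof
    show "L ` (cover -` A) \<subseteq> cover -` (g ` A)" by (auto simp: cover_lift)
    show "cover -` (g ` A) \<subseteq> L ` (cover -` A)"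
    proof
      fix x assume "x \<in> cover -` (g ` A)"
      then have "L' x \<in> cover -` A" by (auto simp: inverse.cover_lift)
      then show "x \<in> L ` (cover -` A)" by (metis image_eqI inverse_simps(4))
    qed
  qed
  then show ?thesis
    using homeomorphism_component_image[OF lift_homeo] assms by (simp add: lifts_def)
qed

text \<open>The lift carries a witnessing chain of lifts to a witnessing chain, and periodicity under
  \<open>deck\<close> survives because the lift commutes with it. The sets \<open>A'\<close> are constrained only at the
  indices that occur in the chain, so that sets given by indexing into a list are covered.\<close>

lemma cyclic_chain_image:
  assumes "cyclic_chain k A s" and A': "\<And>i. i < k \<Longrightarrow> A' i = g ` A i"
  shows "cyclic_chain k A' s"
proof -
  obtain B where B: "\<forall>i<k. B i \<in> lifts (A i)" "\<forall>i. B (i + k) = deck ` B i"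
      "set_chain B (\<lambda>i. s (i mod k))"
    using assms(1) by (auto simp: cyclic_chain_def)
  have "\<forall>i<k. L ` B i \<in> lifts (A' i)" using B(1) A' lifts_image by simp
  moreover have "\<forall>i. L ` B (i + k) = deck ` L ` B i" using B(2) by (simp add: image_image deck_lift)
  moreover have "set_chain (\<lambda>i. L ` B i) (\<lambda>i. s (i mod k))"
    by (rule set_chain_image[OF lift_homeo B(3)])
  ultimately show ?thesis
    unfolding cyclic_chain_def by (intro exI[of _ "\<lambda>i. L ` B i"]) blast
qed

subsection \<open>Reeb components\<close>

lemma hat_image: "hat (g ` F) = map_option g ` hat F"
  by (auto simp: hat_def image_image)

lemma joins_zero_infinity_image:
  assumes "joins_zero_infinity F"
  shows "joins_zero_infinity (g ` F)"
proof -
  have F: "F \<subseteq> - {0}" "closedin (top_of_set (- {0})) F" "connected F" "connectedin sphere2 (hat F)"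
    using assms by (auto simp: joins_zero_infinity_def)
  have "g ` (- {0}) = - {0}"
    using homeomorphism_compl_image[OF homeo, of "{0}"] by simp
  moreover from this have "g' ` (- {0}) = - {0}"
    by (metis image_simps(1))
  ultimately have "homeomorphism (- {0}) (- {0}) g g'"
    using continuous by (auto simp: homeomorphism_def)
  then have "closedin (top_of_set (- {0})) (g ` F)"
    using F(2) homeomorphism_imp_closed_map by blast
  then show ?thesis
    unfolding joins_zero_infinity_def hat_image
    using F connectedin_sphere_image homeomorphism_connected_image[OF homeo] by auto
qed

lemma regions_image:
  assumes "regions F G U V"
  shows "regions (g ` F) (g ` G) (g ` U) (g ` V)"
proof -
  note r = assms[unfolded regions_def]
  have compl: "- (g ` F \<union> g ` G \<union> {0}) = g ` (- (F \<union> G \<union> {0}))"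
    using homeomorphism_compl_image[OF homeo, of "F \<union> G \<union> {0}"] by (simp add: image_Un)
  have closure: "closure (g ` X) \<inter> g ` K \<noteq> {}" if "closure X \<inter> K \<noteq> {}" for X K
    using that homeomorphism_subset_closure_image[OF homeo, of "closure X" X] by blast
  have "cyclic_chain 4 ((!) [g ` F, g ` U, g ` G, g ` V]) (\<lambda>_. True)"
  proof (rule cyclic_chain_image)
    show "cyclic_chain 4 ((!) [F, U, G, V]) (\<lambda>_. True)" using r by blast
    show "[g ` F, g ` U, g ` G, g ` V] ! i = g ` ([F, U, G, V] ! i)" if "i < 4" for i
      using that nth_map[of i "[F, U, G, V]" "image g"] by simp
  qed
  moreover have "g ` F \<inter> g ` G = {}"
    using r homeomorphism_disjoint_image[OF homeo] by blast
  moreover have "g ` U \<noteq> g ` V" using r by (simp add: inj_image_eq_iff[OF inj_g])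
  ultimately show ?thesis
    unfolding regions_def compl
    using r by (intro conjI joins_zero_infinity_image components_image closure) blast+
qed

lemma singular_via_image:
  assumes "singular_via h U x y"
  shows "singular_via (g \<circ> h \<circ> g') (g ` U) (g x) (g y)"
proof -
  interpret inverse: lifted_homeo g' g L' L by (rule lifted_homeo_inverse)
  note s = assms[unfolded singular_via_def]
  have "\<not> same_orbit (g \<circ> h \<circ> g') (g x) (g y)"
    using s by (simp add: same_orbit_def conjugate_funpow inj_eq[OF inj_g])
  moreover have "\<exists>n>0. ((g \<circ> h \<circ> g') ^^ n) ` X \<inter> Y \<inter> g ` U \<noteq> {}"
    if XY: "g x \<in> interior X" "g y \<in> interior Y" for X Y
  proof -
    have nbhd: "z \<in> interior (g' ` Z)" if z: "g z \<in> interior Z" for z Z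
    proof -
      have "open (g' ` interior Z)" by (simp add: inverse.open_image)
      moreover have "g' ` interior Z \<subseteq> g' ` Z" using interior_subset by blast
      ultimately have "g' ` interior Z \<subseteq> interior (g' ` Z)" by (rule interior_maximal[rotated])
      then show ?thesis using z by (metis image_subset_iff inverse_simps(1))
    qed
    obtain n where "n > 0" "(h ^^ n) ` g' ` X \<inter> g' ` Y \<inter> U \<noteq> {}"
      using s nbhd[OF XY(1)] nbhd[OF XY(2)] by blast
    then obtain p q where "p \<in> X" "q \<in> Y" "(h ^^ n) (g' p) = g' q" "g' q \<in> U"
      by (auto simp: image_image)
    then have "q \<in> ((g \<circ> h \<circ> g') ^^ n) ` X" "q \<in> g ` U"
      by (auto simp: conjugate_funpow image_iff) (metis inverse_simps(2))+
    with \<open>q \<in> Y\<close> \<open>n > 0\<close> show ?thesis by blast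
  qed
  ultimately show ?thesis
    unfolding singular_via_def conjugate_image using s open_image by auto
qed

lemma all_singular_image:
  assumes "all_singular f F G"
  shows "all_singular (g \<circ> f \<circ> g') (g ` F) (g ` G)"
  using assms regions_image singular_via_image unfolding all_singular_def by blast

lemma reeb_component_image:
  assumes "bij h" "reeb_component h F G"
  shows "reeb_component (g \<circ> h \<circ> g') (g ` F) (g ` G)"
  using assms(2) joins_zero_infinity_image all_singular_image
    homeomorphism_disjoint_image[OF homeo, of F G]
  unfolding reeb_component_def conjugate_image inv_conjugate[OF assms(1)] by auto

lemma minimal_joining_image:
  assumes "minimal_joining F"
  shows "minimal_joining (g ` F)"
proof -
  interpret inverse: lifted_homeo g' g L' L by (rule lifted_homeo_inverse)
  have "K = g ` F" if K: "joins_zero_infinity K" "K \<subseteq> g ` F" for K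
  proof -
    have "g' ` K \<subseteq> F" using K(2) by auto
    then have "g' ` K = F"
      using assms inverse.joins_zero_infinity_image[OF K(1)] by (auto simp: minimal_joining_def)
    then show ?thesis by auto
  qed
  then show ?thesis using assms joins_zero_infinity_image by (simp add: minimal_joining_def)
qed

lemma minimal_reeb_component_image:
  assumes "bij h" "minimal_reeb_component h F G"
  shows "minimal_reeb_component (g \<circ> h \<circ> g') (g ` F) (g ` G)"
  using assms reeb_component_image minimal_joining_image by (simp add: minimal_reeb_component_def)

lemma bij_conjugate: "bij h \<Longrightarrow> bij (g \<circ> h \<circ> g')"
  using bij_g lifted_homeo.bij_g[OF lifted_homeo_inverse] by (intro bij_comp)

lemma reeb_numbering_image:
  assumes h: "bij h" and "reeb_numbering h d F G"
  shows "reeb_numbering (g \<circ> h \<circ> g') d (\<lambda>k. g ` F k) (\<lambda>k. g ` G k)"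
proof -
  interpret inverse: lifted_homeo g' g L' L by (rule lifted_homeo_inverse)
  note n = assms(2)[unfolded reeb_numbering_def]
  let ?M = "\<lambda>h. {(A, B). minimal_reeb_component h A B}"
  have pull_back: "minimal_reeb_component h (g' ` A) (g' ` B)"
    if "minimal_reeb_component (g \<circ> h \<circ> g') A B" for A B
    using inverse.minimal_reeb_component_image[OF bij_conjugate[OF h] that]
    unfolding image_simps .
  have "bij_betw (map_prod ((`) g) ((`) g)) (?M h) (?M (g \<circ> h \<circ> g'))"
    by (rule bij_betw_byWitness[where f' = "map_prod ((`) g') ((`) g')"])
      (auto simp: minimal_reeb_component_image[OF h] pull_back simp del: o_apply)
  moreover have "bij_betw (\<lambda>k. (F k, G k)) {0..<int d} (?M h)" using n by blast
  ultimately have "bij_betw (map_prod ((`) g) ((`) g) \<circ> (\<lambda>k. (F k, G k))) {0..<int d} (?M (g \<circ> h \<circ> g'))"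
    by (rule bij_betw_trans[rotated])
  moreover have "map_prod ((`) g) ((`) g) \<circ> (\<lambda>k. (F k, G k)) = (\<lambda>k. (g ` F k, g ` G k))"
    by (simp add: fun_eq_iff)
  ultimately have bij: "bij_betw (\<lambda>k. (g ` F k, g ` G k)) {0..<int d} (?M (g \<circ> h \<circ> g'))"
    by (simp only:)
  obtain U V where UV: "\<forall>k. regions (F k) (G k) (U k) (V k)"
    and chain: "cyclic_chain (3 * d)
      (\<lambda>i. [F (int (i div 3)), U (int (i div 3)), G (int (i div 3))] ! (i mod 3)) (\<lambda>i. i mod 3 \<noteq> 2)"
    using n by blast
  have "cyclic_chain (3 * d)
      (\<lambda>i. [g ` F (int (i div 3)), g ` U (int (i div 3)), g ` G (int (i div 3))] ! (i mod 3))
      (\<lambda>i. i mod 3 \<noteq> 2)"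
  proof (rule cyclic_chain_image[OF chain])
    fix i
    show "[g ` F (int (i div 3)), g ` U (int (i div 3)), g ` G (int (i div 3))] ! (i mod 3)
        = g ` ([F (int (i div 3)), U (int (i div 3)), G (int (i div 3))] ! (i mod 3))"
      using nth_map[of "i mod 3" "[F (int (i div 3)), U (int (i div 3)), G (int (i div 3))]" "image g"]
      by simp
  qed
  then show ?thesis
    unfolding reeb_numbering_def using n bij UV regions_image
    by (intro conjI exI[of _ "\<lambda>k. g ` U k"] exI[of _ "\<lambda>k. g ` V k"]) auto
qed

subsection \<open>Dynamical types\<close>

lemma has_connecting_orbit_image:
  assumes h: "bij h" and "has_connecting_orbit h p q K"
  shows "has_connecting_orbit (g \<circ> h \<circ> g') (map_option g p) (map_option g q) (g ` K)"
proof -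
  obtain x where x: "x \<in> K" "alpha_limit h x p" "omega_limit h x q"
    using assms(2) by (auto simp: has_connecting_orbit_def)
  have "alpha_limit (g \<circ> h \<circ> g') (g x) (map_option g p)"
    using limitin_sphere_image[OF x(2)[unfolded alpha_limit_def]]
    by (simp add: alpha_limit_def inv_conjugate[OF h] conjugate_funpow)
  moreover have "omega_limit (g \<circ> h \<circ> g') (g x) (map_option g q)"
    using limitin_sphere_image[OF x(3)[unfolded omega_limit_def]]
    by (simp add: omega_limit_def conjugate_funpow)
  ultimately show ?thesis using x(1) by (auto simp: has_connecting_orbit_def)
qed

lemma has_connecting_orbit_conjugate:
  assumes "bij h"
  shows "has_connecting_orbit (g \<circ> h \<circ> g') (map_option g p) (map_option g q) (g ` K)
    \<longleftrightarrow> has_connecting_orbit h p q K"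
proof
  interpret inverse: lifted_homeo g' g L' L by (rule lifted_homeo_inverse)
  assume "has_connecting_orbit (g \<circ> h \<circ> g') (map_option g p) (map_option g q) (g ` K)"
  from inverse.has_connecting_orbit_image[OF bij_conjugate[OF assms] this]
  show "has_connecting_orbit h p q K"
    by (simp add: option.map_comp option.map_ident_strong comp_def image_image)
qed (rule has_connecting_orbit_image[OF assms])

lemma type_conjugate:
  assumes "bij h"
  shows "type_zero_infinity (g \<circ> h \<circ> g') (g ` K) \<longleftrightarrow> type_zero_infinity h K"
    and "type_infinity_zero (g \<circ> h \<circ> g') (g ` K) \<longleftrightarrow> type_infinity_zero h K"
  using has_connecting_orbit_conjugate[OF assms, of "Some 0" None K]
    has_connecting_orbit_conjugate[OF assms, of None "Some 0" K]
  by (simp_all add: type_zero_infinity_def type_infinity_zero_def del: o_apply)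

subsection \<open>Quarter-turn index\<close>

lemma quarter_turn_indexation_conjugate:
  assumes h: "bij h" and "quarter_turn_indexation h m"
  shows "quarter_turn_indexation (g \<circ> h \<circ> g') m"
proof -
  note q = assms(2)[unfolded quarter_turn_indexation_def]
  then obtain F G where FG: "reeb_numbering h (plane_module h) F G"
    and m: "\<And>k. m (2 * k) = Rightward \<and> all_singular h (F k) (G k) \<or>
          m (2 * k) = Leftward \<and> all_singular (inv h) (F k) (G k)"
      "\<And>k. m (2 * k + 1) = Upward \<and> type_infinity_zero h (G k) \<and> type_infinity_zero h (F (k + 1)) \<or>
          m (2 * k + 1) = Downward \<and> type_zero_infinity h (G k) \<and> type_zero_infinity h (F (k + 1))"
    by blast
  show ?thesis
    unfolding quarter_turn_indexation_def plane_module_conjugate inv_conjugate[OF h]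
  proof (intro conjI exI allI)
    show "indexed_cyclic_word (2 * plane_module h) m" using q by blast
    show "reeb_numbering (g \<circ> h \<circ> g') (plane_module h) (\<lambda>k. g ` F k) (\<lambda>k. g ` G k)"
      by (rule reeb_numbering_image[OF h FG])
    fix k
    show "m (2 * k) = Rightward \<and> all_singular (g \<circ> h \<circ> g') (g ` F k) (g ` G k) \<or>
        m (2 * k) = Leftward \<and> all_singular (g \<circ> inv h \<circ> g') (g ` F k) (g ` G k)"
      using m(1)[of k] all_singular_image by blast
    show "m (2 * k + 1) = Upward \<and>
        type_infinity_zero (g \<circ> h \<circ> g') (g ` G k) \<and> type_infinity_zero (g \<circ> h \<circ> g') (g ` F (k + 1)) \<or>
      m (2 * k + 1) = Downward \<and>
        type_zero_infinity (g \<circ> h \<circ> g') (g ` G k) \<and> type_zero_infinity (g \<circ> h \<circ> g') (g ` F (k + 1))"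
      unfolding type_conjugate[OF h] by (rule m(2))
  qed
qed

lemma quarter_turn_index_conjugate:
  assumes h: "bij h"
  shows "quarter_turn_index (g \<circ> h \<circ> g') = quarter_turn_index h"
proof -
  interpret inverse: lifted_homeo g' g L' L by (rule lifted_homeo_inverse)
  have "quarter_turn_indexation (g \<circ> h \<circ> g') m \<longleftrightarrow> quarter_turn_indexation h m" for m
    using quarter_turn_indexation_conjugate[OF h]
      inverse.quarter_turn_indexation_conjugate[OF bij_conjugate[OF h], of m]
    unfolding image_simps by blast
  then show ?thesis by (simp add: quarter_turn_index_def plane_module_conjugate del: o_apply)
qed

end

theorem mainTheorem2:
  fixes h g :: "complex \<Rightarrow> complex"
  assumes "orientation_preserving_homeo h"
    and "{z. h z = z} = {0}"
    and "fixed_point_index h 0 \<noteq> 1"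
    and "orientation_preserving_homeo g"
    and "g 0 = 0"
  shows "quarter_turn_index h = quarter_turn_index (g \<circ> h \<circ> inv g)"
proof -
  obtain L L' where "lifted_homeo g (inv g) L L'"
    using orientation_preserving_lifted_homeo[OF assms(4,5)] .
  moreover have "bij h"
    using assms(1) homeomorphism_inj_surj
    unfolding orientation_preserving_homeo_def plane_homeo_def bij_def by blast
  ultimately show ?thesis
    using lifted_homeo.quarter_turn_index_conjugate by metis
qed

end
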